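(* Let $a,r,k>0$, $h\ge0$ and $$I(a,r,k,h)=\inf_{(\mu,\rho)}\int_{\mathbb R}rx^2\,\mu(dx)+\int_{\mathbb R\times(\mathbb R\setminus\{0\})}(k+h|\xi|)\,\rho(dx,d\xi),$$ where the infimum is over Borel probability measures $\mu$ on $\mathbb R$ and finite nonnegative Borel measures $\rho$ on $\mathbb R\times(\mathbb R\setminus\{0\})$ satisfying $$\int_{\mathbb R}\tfrac12af''(x)\,\mu(dx)+\int_{\mathbb R\times(\mathbb R\setminus\{0\})}\big(f(x+\xi)-f(x)\big)\rho(dx,d\xi)=0\qquad\text{for all }f\in C^2_0(\mathbb R).$$ Let $\theta_1,\theta_2\in\mathbb R$ and $0\le\tilde x^*<x^*$ be solutions of the system $$6a\theta_1+r=0,\qquad P(x^* )-P(\tilde x^* )=k+h(x^*-\tilde x^* ),\qquad P'(x^* )=h,\qquad P'(\tilde x^* )=h,$$ where $P(x)=\theta_1x^4+\theta_2x^2$. Then $$I(a,r,k,h)=a\theta_2,$$ and the optimum is attained by $\mu^*=p(x)\,dx$ with $$p(x)=\begin{cases}\frac1{(x^* )^2-(\tilde x^* )^2}(x+x^* ),&-x^*\le x<-\tilde x^*,\\ \frac1{x^*+\tilde x^*},&-\tilde x^*\le x\le\tilde x^*,\\ \frac1{(x^* )^2-(\tilde x^* )^2}(x^*-x),&\tilde x^*<x\le x^*,\end{cases}$$ ($p=0$ outside $[-x^*,x^*]$) and $$\rho^*=\frac a{(x^* )^2-(\tilde x^* )^2}\Big(\tfrac12\delta_{(x^*,\,\tilde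 x^*-x^* )}+\tfrac12\delta_{(-x^*,\,-\tilde x^*+x^* )}\Big).$$
   Context: $C^2_0(\mathbb R)$ is the set of twice continuously differentiable real functions on $\mathbb R$ with compact support; $\delta_y$ is the Dirac mass at $y$. *)

theory Defs
  imports "HOL-Probability.Probability"
begin

definition C2_compact :: "(real \<Rightarrow> real) set" where
  "C2_compact = {f. (\<forall>x. f differentiable (at x)) \<and> (\<forall>x. deriv f differentiable (at x)) \<and>
     continuous_on UNIV (deriv (deriv f)) \<and> compact (closure {x. f x \<noteq> 0})}"

text \<open>The state--jump space, pairs \<open>(x, \<xi>)\<close> with \<open>\<xi> \<noteq> 0\<close>, with its Borel sets.\<close>

definition jump_borel :: "(real \<times> real) measure" where
  "jump_borel = restrict_space borel (UNIV \<times> (UNIV - {0}))"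

text \<open>The integrands in the constraint are bounded and measurable, so that for the finite
  measures considered the Bochner integrals are genuine.\<close>

definition admissible :: "real \<Rightarrow> real measure \<Rightarrow> (real \<times> real) measure \<Rightarrow> bool" where
  "admissible a \<mu> \<rho> \<longleftrightarrow>
     prob_space \<mu> \<and> sets \<mu> = sets borel \<and>
     finite_measure \<rho> \<and> sets \<rho> = sets jump_borel \<and>
     (\<forall>f\<in>C2_compact.
        (\<integral>x. 1/2 * a * deriv (deriv f) x \<partial>\<mu>) + (\<integral>(x, \<xi>). f (x + \<xi>) - f x \<partial>\<rho>) = 0)"

text \<open>The cost may be infinite; for \<open>r, k > 0\<close> and \<open>h \<ge> 0\<close> the integrands are nonnegative.\<close>

definition cost :: "real \<Rightarrow> real \<Rightarrow> real \<Rightarrow> real measure \<Rightarrow> (real \<times> real) measure \<Rightarrow> ennreal" where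
  "cost r k h \<mu> \<rho> =
     (\<integral>\<^sup>+x. ennreal (r * x\<^sup>2) \<partial>\<mu>) + (\<integral>\<^sup>+(x, \<xi>). ennreal (k + h * \<bar>\<xi>\<bar>) \<partial>\<rho>)"

definition opt_cost :: "real \<Rightarrow> real \<Rightarrow> real \<Rightarrow> real \<Rightarrow> ennreal" where
  "opt_cost a r k h = (INF (\<mu>, \<rho>)\<in>{(\<mu>, \<rho>). admissible a \<mu> \<rho>}. cost r k h \<mu> \<rho>)"

definition quartic :: "real \<Rightarrow> real \<Rightarrow> real \<Rightarrow> real" where
  "quartic \<theta>1 \<theta>2 x = \<theta>1 * x^4 + \<theta>2 * x^2"

text \<open>Below, \<open>xs\<close> is the threshold \<open>x\<^sup>*\<close> at which a jump occurs, and \<open>xt\<close> is the point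
  \<open>x\<^sup>*\<close>-tilde (the smaller one) to which the process jumps.\<close>

definition opt_density :: "real \<Rightarrow> real \<Rightarrow> real \<Rightarrow> real" where
  "opt_density xs xt x =
     (if - xs \<le> x \<and> x < - xt then 1 / (xs\<^sup>2 - xt\<^sup>2) * (x + xs)
      else if - xt \<le> x \<and> x \<le> xt then 1 / (xs + xt)
      else if xt < x \<and> x \<le> xs then 1 / (xs\<^sup>2 - xt\<^sup>2) * (xs - x)
      else 0)"

definition opt_occupation :: "real \<Rightarrow> real \<Rightarrow> real measure" where
  "opt_occupation xs xt = density lborel (\<lambda>x. ennreal (opt_density xs xt x))"

definition opt_jump :: "real \<Rightarrow> real \<Rightarrow> real \<Rightarrow> (real \<times> real) measure" where
  "opt_jump a xs xt = measure_of (space jump_borel) (sets jump_borel)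
     (\<lambda>A. ennreal (a / (xs\<^sup>2 - xt\<^sup>2)) *
        (ennreal (1/2) * emeasure (return jump_borel (xs, xt - xs)) A +
         ennreal (1/2) * emeasure (return jump_borel (- xs, - xt + xs)) A))"

lemma sets_opt_jump [simp]: "sets (opt_jump a xs xt) = sets jump_borel"
  by (simp add: opt_jump_def)

text \<open>The set function in \<^const>\<open>opt_jump\<close> is countably additive, so it is the measure.\<close>

lemma emeasure_opt_jump:
  assumes "A \<in> sets jump_borel"
  shows "emeasure (opt_jump a xs xt) A = ennreal (a / (xs\<^sup>2 - xt\<^sup>2)) *
     (ennreal (1/2) * indicator A (xs, xt - xs) + ennreal (1/2) * indicator A (- xs, - xt + xs))"
proof -
  let ?f = "\<lambda>A. ennreal (a / (xs\<^sup>2 - xt\<^sup>2)) *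
        (ennreal (1/2) * emeasure (return jump_borel (xs, xt - xs)) A +
         ennreal (1/2) * emeasure (return jump_borel (- xs, - xt + xs)) A)"
  have "emeasure (opt_jump a xs xt) A = ?f A"
    unfolding opt_jump_def
  proof (rule emeasure_measure_of_sigma)
    show "sigma_algebra (space jump_borel) (sets jump_borel)"
      by (rule sets.sigma_algebra_axioms)
    show "positive (sets jump_borel) ?f"
      by (simp add: positive_def)
    show "countably_additive (sets jump_borel) ?f"
    proof (rule countably_additiveI)
      fix B :: "nat \<Rightarrow> (real \<times> real) set"
      assume B: "range B \<subseteq> sets jump_borel" "disjoint_family B"
      have *: "(\<Sum>i. emeasure (return jump_borel p) (B i)) = emeasure (return jump_borel p) (\<Union>i. B i)"
        for p using B by (intro suminf_emeasure) auto
      show "(\<Sum>i. ?f (B i)) = ?f (\<Union>i. B i)"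
        by (simp add: * ennreal_suminf_cmult suminf_add [symmetric])
    qed
  qed (rule assms)
  then show ?thesis
    using assms by simp
qed

end

theory Submission
  imports Defs
begin

text \<open>Lower bound, by duality: let \<open>w\<close> be \<open>P\<close> on \<open>[- xs, xs]\<close>, continued outside with slope \<open>\<plusminus>h\<close>.
  Then \<open>w x - w y \<le> k + h * \<bar>x - y\<bar>\<close>, and \<open>w - P\<close> is convex while
  \<open>a/2 * P'' x = a * \<theta>2 - r * x\<^sup>2\<close>; so \<open>w\<close>, inserted in the constraint, gives cost at least \<open>a * \<theta>2\<close>.
  As \<open>w\<close> is neither \<open>C\<^sup>2\<close> nor compactly supported, it is first cut off by minima and maxima and then
  averaged with a tent kernel of width \<open>d\<close>. Both operations keep the jump inequality, and averaging
  turns the second derivative into a second difference quotient, which for \<open>P\<close> is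
  \<open>P'' + 2 * \<theta>1 * d\<^sup>2\<close>; the error vanishes with \<open>d\<close>.

  Optimality: \<open>p\<close> is the difference of the tents \<open>max 0 (xs - \<bar>x\<bar>)\<close> and \<open>max 0 (xt - \<bar>x\<bar>)\<close>, divided
  by \<open>xs\<^sup>2 - xt\<^sup>2\<close>, and the integral of \<open>f''\<close> against a tent of half-width \<open>c\<close> is
  \<open>f c + f (- c) - 2 * f 0\<close>.\<close>

section \<open>Second differences, smoothing and truncation\<close>

text \<open>The symmetrization \<open>E\<close> of \<open>U\<close> about \<open>x\<close>, less
  \<open>c * z\<^sup>2\<close>, has \<open>E' 0 = 0\<close> and \<open>E'\<close> nonincreasing on
  [0, d], so \<open>E\<close> itself decreases from 0 to \<open>d\<close>.\<close>

lemma second_difference_le: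
  fixes U U' U'' :: "real \<Rightarrow> real"
  assumes U': "\<And>x. (U has_real_derivative U' x) (at x)"
    and U'': "\<And>x. (U' has_real_derivative U'' x) (at x)"
    and le: "\<And>z. \<bar>z\<bar> \<le> d \<Longrightarrow> U'' (x + z) \<le> c" and d: "0 \<le> d"
  shows "U (x + d) - 2 * U x + U (x - d) \<le> c * d\<^sup>2"
proof -
  define E where "E z = U (x + z) + U (x - z) - c * z\<^sup>2" for z
  define E' where "E' z = U' (x + z) - U' (x - z) - 2 * c * z" for z
  have dE: "(E has_real_derivative E' z) (at z)" for z
    unfolding E_def E'_def
    by (auto intro!: derivative_eq_intros DERIV_chain'[OF _ U'])
  have dE': "(E' has_real_derivative (U'' (x + z) + U'' (x - z) - 2 * c)) (at z)" for z
    unfolding E'_def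
    by (auto intro!: derivative_eq_intros DERIV_chain'[OF _ U''])
  have "E' z \<le> 0" if "0 \<le> z" "z \<le> d" for z
  proof -
    have "E' z \<le> E' 0"
    proof (rule DERIV_nonpos_imp_nonincreasing[OF \<open>0 \<le> z\<close>])
      fix y assume "0 \<le> y" "y \<le> z"
      then have "U'' (x + y) \<le> c" "U'' (x - y) \<le> c"
        using le[of y] le[of "- y"] that by auto
      then show "\<exists>t. (E' has_real_derivative t) (at y) \<and> t \<le> 0"
        using dE' by (intro exI[of _ "U'' (x + y) + U'' (x - y) - 2 * c"]) auto
    qed
    then show ?thesis by (simp add: E'_def)
  qed
  then have "E d \<le> E 0"
    using dE by (intro DERIV_nonpos_imp_nonincreasing[OF d]) blast
  then show ?thesis by (simp add: E_def)
qed

lemma continuous_has_second_antiderivative: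
  fixes W :: "real \<Rightarrow> real"
  assumes "continuous_on UNIV W"
  obtains G G' where "\<And>x. (G has_real_derivative G' x) (at x)"
    "\<And>x. (G' has_real_derivative W x) (at x)"
proof -
  have anti: "\<exists>F. \<forall>x. (F has_real_derivative f x) (at x)"
    if "\<And>x. isCont f x" for f :: "real \<Rightarrow> real"
    using einterval_antiderivative[of "-\<infinity>" \<infinity> f] that
    by (auto simp: has_real_derivative_iff_has_vector_derivative)
  have "\<And>x. isCont W x"
    using assms by (simp add: continuous_on_eq_continuous_at)
  from anti[OF this] obtain G' where G': "\<And>x. (G' has_real_derivative W x) (at x)" by blast
  then have "\<And>x. isCont G' x" using DERIV_isCont by blast
  from anti[OF this] obtain G where "\<And>x. (G has_real_derivative G' x) (at x)" by blast
  with G' that show thesis by blast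
qed

text \<open>Here \<open>f\<close> is \<open>W\<close> averaged with a tent kernel of half-width \<open>d\<close>, written as a second difference
  of a second antiderivative of \<open>W\<close>; averages inherit every bound on differences of \<open>W\<close>.\<close>

lemma C2_smoothing:
  fixes W :: "real \<Rightarrow> real"
  assumes cont: "continuous_on UNIV W" and d: "0 < d" and supp: "\<And>x. B \<le> \<bar>x\<bar> \<Longrightarrow> W x = 0"
  obtains f where "f \<in> C2_compact"
    "\<And>x. deriv (deriv f) x = (W (x + d) - 2 * W x + W (x - d)) / d\<^sup>2"
    "\<And>x y c. (\<And>z. W (x + z) - W (y + z) \<le> c) \<Longrightarrow> f x - f y \<le> c"
proof -
  obtain G G' where G: "\<And>x. (G has_real_derivative G' x) (at x)"
    and G': "\<And>x. (G' has_real_derivative W x) (at x)"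
    using continuous_has_second_antiderivative[OF cont] by blast
  define f where "f x = (G (x + d) - 2 * G x + G (x - d)) / d\<^sup>2" for x
  define f' where "f' x = (G' (x + d) - 2 * G' x + G' (x - d)) / d\<^sup>2" for x
  define f'' where "f'' x = (W (x + d) - 2 * W x + W (x - d)) / d\<^sup>2" for x
  have df: "(f has_real_derivative f' x) (at x)" for x
    unfolding f_def f'_def
    by (rule DERIV_cdivide) (auto intro!: derivative_eq_intros DERIV_chain'[OF _ G])
  have df': "(f' has_real_derivative f'' x) (at x)" for x
    unfolding f'_def f''_def
    by (rule DERIV_cdivide) (auto intro!: derivative_eq_intros DERIV_chain'[OF _ G'])
  have f': "deriv f = f'" using df DERIV_imp_deriv by blast
  have f'': "deriv f' = f''" using df' DERIV_imp_deriv by blast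
  have fd: "f x * d\<^sup>2 = G (x + d) - 2 * G x + G (x - d)" for x
    using d by (simp add: f_def)
  have diff_le: "f x - f y \<le> c"
    if le: "\<And>z. W (x + z) - W (y + z) \<le> c" for x y c
  proof -
    \<comment> \<open>The translation difference of \<open>G\<close> has second derivative W (x + z)
      - W (y + z), which is at most \<open>c\<close> for every \<open>z\<close>.\<close>
    have "(\<lambda>z. G (x + z) - G (y + z)) (0 + d) - 2 * (\<lambda>z. G (x + z) - G (y + z)) 0
        + (\<lambda>z. G (x + z) - G (y + z)) (0 - d) \<le> c * d\<^sup>2"
      by (rule second_difference_le[where U' = "\<lambda>z. G' (x + z) - G' (y + z)"
            and U'' = "\<lambda>z. W (x + z) - W (y + z)"])
        (use d le in \<open>auto intro!: derivative_eq_intros DERIV_chain'[OF _ G] DERIV_chain'[OF _ G']\<close>)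
    then have "(f x - f y) * d\<^sup>2 \<le> c * d\<^sup>2"
      by (simp add: left_diff_distrib fd)
    then show ?thesis using d by simp
  qed
  have vanish: "f x = 0" if "B + d \<le> \<bar>x\<bar>" for x
  proof -
    have W0: "W (x + z) = 0" if "\<bar>z\<bar> \<le> d" for z
      using that \<open>B + d \<le> \<bar>x\<bar>\<close> by (intro supp) linarith
    \<comment> \<open>\<open>G\<close> is affine on [x - d, x + d]; the bound 0 for both
      \<open>G\<close> and \<open>- G\<close> forces the second difference to vanish.\<close>
    have "G (x + d) - 2 * G x + G (x - d) \<le> 0 * d\<^sup>2"
      by (rule second_difference_le[OF G G']) (use W0 d in auto)
    moreover have "- G (x + d) - 2 * (- G x) + (- G (x - d)) \<le> 0 * d\<^sup>2"
      by (rule second_difference_le[where U' = "\<lambda>x. - G' x" and U'' = "\<lambda>x. - W x"])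
        (use W0 d in \<open>auto intro!: DERIV_minus G G'\<close>)
    ultimately show ?thesis by (simp add: f_def)
  qed
  have "{x. f x \<noteq> 0} \<subseteq> {- (B + d)..B + d}"
  proof
    fix x assume "x \<in> {x. f x \<noteq> 0}"
    then have "\<bar>x\<bar> < B + d" using vanish[of x] by (force simp: not_le)
    then show "x \<in> {- (B + d)..B + d}" by auto
  qed
  then have "compact (closure {x. f x \<noteq> 0})"
    by (meson bounded_closed_interval bounded_subset compact_closure)
  moreover have "continuous_on UNIV f''"
    unfolding f''_def
    by (intro continuous_intros continuous_on_compose2[OF cont]) (use d in auto)
  ultimately have "f \<in> C2_compact"
    unfolding C2_compact_def using df df' f' f'' by (auto simp: real_differentiable_def)
  then show thesis
    using that[of f] diff_le by (auto simp: f' f'' f''_def)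
qed

text \<open>Cap \<open>w\<close> by the cone c - s|x| and take the positive part. For h > 0 the cone
  has slope h, so it obeys the jump inequality, which minima and maxima preserve.\<close>

lemma compact_cutoff:
  fixes w :: "real \<Rightarrow> real"
  assumes cont: "continuous_on UNIV w" and nonneg: "\<And>x. 0 \<le> w x" and w0: "w 0 = 0"
    and jump: "\<And>x y. w x - w y \<le> k + h * \<bar>x - y\<bar>"
    and "0 \<le> k" "0 \<le> h" "0 \<le> R"
  obtains W B where "continuous_on UNIV W" "\<And>x. 0 \<le> W x" "\<And>x. W x \<le> w x"
    "\<And>x. \<bar>x\<bar> \<le> R \<Longrightarrow> W x = w x" "\<And>x. B \<le> \<bar>x\<bar> \<Longrightarrow> W x = 0"
    "\<And>x y. W x - W y \<le> k + h * \<bar>x - y\<bar>"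
proof -
  text \<open>For \<open>h = 0\<close> any positive slope will do: then \<open>w\<close> has oscillation at most \<open>k\<close>.\<close>
  define s where "s = (if h = 0 then 1 else h)"
  \<comment> \<open>For |x| \<le> R the cone is then at least k + h R, hence above \<open>w\<close>,
    which grows at most like k + h|x|.\<close>
  define c where "c = k + h * R + s * R"
  define W where "W x = max 0 (min (w x) (c - s * \<bar>x\<bar>))" for x
  have s: "0 < s" using \<open>0 \<le> h\<close> by (simp add: s_def)
  have growth: "w x \<le> k + h * \<bar>x\<bar>" for x using jump[of x 0] w0 by simp
  have 1: "continuous_on UNIV W" unfolding W_def by (intro continuous_intros cont)
  have 2: "0 \<le> W x" for x by (simp add: W_def)
  have 3: "W x \<le> w x" for x using nonneg[of x] by (simp add: W_def)
  have 4: "W x = w x" if "\<bar>x\<bar> \<le> R" for x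
  proof -
    have "h * \<bar>x\<bar> \<le> h * R" "s * \<bar>x\<bar> \<le> s * R"
      using that s \<open>0 \<le> h\<close> by (auto intro: mult_left_mono)
    then have "w x \<le> c - s * \<bar>x\<bar>" using growth[of x] by (simp add: c_def)
    then show ?thesis using nonneg[of x] by (simp add: W_def)
  qed
  have 5: "W x = 0" if "c / s \<le> \<bar>x\<bar>" for x
  proof -
    have "c \<le> s * \<bar>x\<bar>" using that s by (simp add: field_simps)
    then show ?thesis by (auto simp: W_def)
  qed
  have 6: "W x - W y \<le> k + h * \<bar>x - y\<bar>" for x y
  proof (cases "h = 0")
    case True
    then show ?thesis using 2[of y] 3[of x] growth[of x] by simp
  next
    case False
    have "h * \<bar>y\<bar> \<le> h * \<bar>x\<bar> + h * \<bar>x - y\<bar>"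
      unfolding distrib_left[symmetric] using \<open>0 \<le> h\<close> by (intro mult_left_mono) auto
    moreover have "0 \<le> h * \<bar>x - y\<bar>" using \<open>0 \<le> h\<close> by simp
    ultimately show ?thesis
      using False jump[of x y] \<open>0 \<le> k\<close> by (simp add: W_def s_def max_def min_def)
  qed
  show thesis using that[OF 1 2 3 4 5 6] .
qed

section \<open>Weak duality for compactly supported test functions\<close>

lemma C2_compact_continuous: "f \<in> C2_compact \<Longrightarrow> continuous_on UNIV f"
  by (auto simp: C2_compact_def continuous_on_eq_continuous_at
      intro: differentiable_imp_continuous_within)

lemma bounded_range_of_vanishing_outside_compact:
  fixes g :: "real \<Rightarrow> real"
  assumes "continuous_on UNIV g" "compact K" "\<And>x. x \<notin> K \<Longrightarrow> g x = 0"
  shows "bounded (range g)"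
proof -
  have "bounded (insert 0 (g ` K))"
    using assms continuous_on_subset[OF assms(1), of K] compact_continuous_image compact_imp_bounded
    by (metis bounded_insert top_greatest)
  then show ?thesis
    by (rule bounded_subset) (use assms(3) in auto)
qed

lemma deriv_zero_outside_support:
  fixes f :: "real \<Rightarrow> real"
  assumes "closed K" "\<And>x. x \<notin> K \<Longrightarrow> f x = 0" "x \<notin> K"
  shows "deriv f x = 0"
proof -
  have "eventually (\<lambda>y. f y = (\<lambda>_. 0) y) (nhds x)"
    using assms by (auto simp: eventually_nhds intro!: exI[of _ "- K"])
  then show ?thesis using deriv_cong_ev[of f "\<lambda>_. 0" x x] by simp
qed

lemma C2_compact_bounded:
  assumes "f \<in> C2_compact"
  shows "bounded (range f)" "bounded (range (deriv (deriv f)))"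
proof -
  define K where "K = closure {x. f x \<noteq> 0}"
  have K: "compact K" "closed K" and cont: "continuous_on UNIV (deriv (deriv f))"
    using assms by (auto simp: K_def C2_compact_def)
  have f0: "x \<notin> K \<Longrightarrow> f x = 0" for x
    using closure_subset[of "{x. f x \<noteq> 0}"] by (auto simp: K_def)
  show "bounded (range f)"
    using bounded_range_of_vanishing_outside_compact C2_compact_continuous[OF assms] K(1) f0 by blast
  have "x \<notin> K \<Longrightarrow> deriv (deriv f) x = 0" for x
    using deriv_zero_outside_support[OF K(2), of "deriv f"]
      deriv_zero_outside_support[OF K(2), of f] f0 by blast
  then show "bounded (range (deriv (deriv f)))"
    using bounded_range_of_vanishing_outside_compact[OF cont K(1)] by blast
qed

text \<open>Integrate \<open>gen\<close> against \<open>\<mu>\<close> and \<open>jump\<close>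
  against \<open>\<rho>\<close> and add: the terms containing \<open>f\<close> cancel by the
  constraint, and the cost remains.\<close>

lemma cost_lower_bound:
  assumes adm: "admissible a \<mu> \<rho>" and f: "f \<in> C2_compact" and nonneg: "0 \<le> r" "0 \<le> k" "0 \<le> h"
    and gen: "\<And>x. m - r * x\<^sup>2 \<le> 1/2 * a * deriv (deriv f) x"
    and jump: "\<And>x \<xi>. f x - f (x + \<xi>) \<le> k + h * \<bar>\<xi>\<bar>"
  shows "ennreal m \<le> cost r k h \<mu> \<rho>"
\<comment> \<open>Infinite cost is trivial; finite cost makes both cost integrands integrable, so
  that Bochner integrals can be added and compared.\<close>
proof (cases "cost r k h \<mu> \<rho> = \<top>")
  case False
  interpret \<mu>: prob_space \<mu> using adm by (simp add: admissible_def)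
  interpret \<rho>: finite_measure \<rho> using adm by (simp add: admissible_def)
  let ?f2 = "deriv (deriv f)"
  have [measurable_cong]: "sets \<mu> = sets borel"
    and \<rho>: "sets \<rho> = sets jump_borel" using adm by (auto simp: admissible_def)
  have \<rho>_meas: "g \<in> borel_measurable \<rho>" if "g \<in> borel_measurable borel" for g :: "real \<times> real \<Rightarrow> real"
    using measurable_restrict_space1[OF that] \<rho>
    by (simp add: jump_borel_def cong: measurable_cong_sets)
  have fm[measurable]: "f \<in> borel_measurable borel" "?f2 \<in> borel_measurable borel"
    using f C2_compact_continuous[OF f]
    by (auto simp: C2_compact_def intro: borel_measurable_continuous_onI)
  obtain C C2 where C: "\<And>x. \<bar>f x\<bar> \<le> C" and C2: "\<And>x. \<bar>?f2 x\<bar> \<le> C2"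
    using C2_compact_bounded[OF f] by (auto simp: bounded_iff)
  have int_f2: "integrable \<mu> ?f2"
    using C2 by (intro \<mu>.integrable_const_bound[where B = C2]) auto
  have "\<bar>f (x + \<xi>) - f x\<bar> \<le> 2 * C" for x \<xi>
    using C[of "x + \<xi>"] C[of x] by linarith
  then have int_f: "integrable \<rho> (\<lambda>(x, \<xi>). f (x + \<xi>) - f x)"
    by (intro \<rho>.integrable_const_bound[where B = "2 * C"] \<rho>_meas)
      (auto simp: borel_prod[symmetric])
  have fin: "(\<integral>\<^sup>+x. ennreal (r * x\<^sup>2) \<partial>\<mu>) < \<infinity>" "(\<integral>\<^sup>+(x, \<xi>). ennreal (k + h * \<bar>\<xi>\<bar>) \<partial>\<rho>) < \<infinity>"
    using False by (auto simp: cost_def less_top)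
  have int_q: "integrable \<mu> (\<lambda>x. r * x\<^sup>2)"
    by (rule integrableI_nonneg) (use fin nonneg in auto)
  have int_k: "integrable \<rho> (\<lambda>(x, \<xi>). k + h * \<bar>\<xi>\<bar>)"
    by (rule integrableI_nonneg)
      (use fin nonneg in \<open>auto intro!: \<rho>_meas simp: borel_prod[symmetric] split_beta'\<close>)
  have cost_eq: "cost r k h \<mu> \<rho> = ennreal ((\<integral>x. r * x\<^sup>2 \<partial>\<mu>) + (\<integral>(x, \<xi>). k + h * \<bar>\<xi>\<bar> \<partial>\<rho>))"
    unfolding cost_def
    using nn_integral_eq_integral[OF int_q] nn_integral_eq_integral[OF int_k] nonneg
    by (simp add: split_beta' ennreal_plus)
  have "m = (\<integral>x. m \<partial>\<mu>)" by (simp add: \<mu>.prob_space)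
  also have "\<dots> \<le> (\<integral>x. 1/2 * a * ?f2 x + r * x\<^sup>2 \<partial>\<mu>)"
  proof (rule integral_mono)
    show "integrable \<mu> (\<lambda>x. 1/2 * a * ?f2 x + r * x\<^sup>2)" using int_f2 int_q by simp
    show "m \<le> 1/2 * a * ?f2 x + r * x\<^sup>2" for x using gen[of x] by simp
  qed simp
  also have "\<dots> = (\<integral>x. 1/2 * a * ?f2 x \<partial>\<mu>) + (\<integral>x. r * x\<^sup>2 \<partial>\<mu>)"
    using int_f2 int_q by (intro Bochner_Integration.integral_add) auto
  finally have 1: "m \<le> (\<integral>x. 1/2 * a * ?f2 x \<partial>\<mu>) + (\<integral>x. r * x\<^sup>2 \<partial>\<mu>)" .
  have "0 \<le> (\<integral>p. (case p of (x, \<xi>) \<Rightarrow> f (x + \<xi>) - f x) + (case p of (x, \<xi>) \<Rightarrow> k + h * \<bar>\<xi>\<bar>) \<partial>\<rho>)"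
  proof (rule Bochner_Integration.integral_nonneg)
    fix p :: "real \<times> real"
    show "0 \<le> (case p of (x, \<xi>) \<Rightarrow> f (x + \<xi>) - f x) + (case p of (x, \<xi>) \<Rightarrow> k + h * \<bar>\<xi>\<bar>)"
      using jump[of "fst p" "snd p"] by (simp add: split_beta')
  qed
  also have "\<dots> = (\<integral>(x, \<xi>). f (x + \<xi>) - f x \<partial>\<rho>) + (\<integral>(x, \<xi>). k + h * \<bar>\<xi>\<bar> \<partial>\<rho>)"
    by (rule Bochner_Integration.integral_add[OF int_f int_k])
  finally have 2: "0 \<le> (\<integral>(x, \<xi>). f (x + \<xi>) - f x \<partial>\<rho>) + (\<integral>(x, \<xi>). k + h * \<bar>\<xi>\<bar> \<partial>\<rho>)" .
  have "(\<integral>x. 1/2 * a * ?f2 x \<partial>\<mu>) + (\<integral>(x, \<xi>). f (x + \<xi>) - f x \<partial>\<rho>) = 0"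
    using adm f by (auto simp: admissible_def)
  with 1 2 show ?thesis unfolding cost_eq by (intro ennreal_leI) linarith
qed simp

section \<open>Integration against the optimal occupation measure\<close>

text \<open>Integration by parts on each side of 0, with antiderivatives (c - x) F' + F and (c + x)
  F' - F; the two terms c F'(0) cancel.\<close>

lemma tent_has_bochner_integral:
  fixes F F' F'' :: "real \<Rightarrow> real"
  assumes F: "\<And>x. (F has_real_derivative F' x) (at x)"
    and F': "\<And>x. (F' has_real_derivative F'' x) (at x)"
    and cont: "\<And>x. isCont F'' x" and c: "0 \<le> c"
  shows "has_bochner_integral lborel (\<lambda>x. max 0 (c - \<bar>x\<bar>) * F'' x) (F c + F (- c) - 2 * F 0)"
proof -
  have R: "has_bochner_integral lborel (\<lambda>x. ((c - x) * F'' x) * indicator {0..c} x)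
      (((c - c) * F' c + F c) - ((c - 0) * F' 0 + F 0))"
    by (rule has_bochner_integral_FTC_Icc_real[OF c])
      (use cont in \<open>auto intro!: derivative_eq_intros F F' continuous_intros simp: algebra_simps\<close>)
  have L: "has_bochner_integral lborel (\<lambda>x. ((c + x) * F'' x) * indicator {- c..0} x)
      (((c + 0) * F' 0 - F 0) - ((c + - c) * F' (- c) - F (- c)))"
    by (rule has_bochner_integral_FTC_Icc_real)
      (use c cont in \<open>auto intro!: derivative_eq_intros F F' continuous_intros simp: algebra_simps\<close>)
  have [measurable]: "F'' \<in> borel_measurable borel"
    using cont by (intro borel_measurable_continuous_onI) (simp add: continuous_on_eq_continuous_at)
  \<comment> \<open>The closed intervals share the point 0, where the sum counts twice, so equality
    holds only almost everywhere.\<close>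
  have "AE x in lborel. ((c - x) * F'' x) * indicator {0..c} x
      + ((c + x) * F'' x) * indicator {- c..0} x = max 0 (c - \<bar>x\<bar>) * F'' x"
    using AE_lborel_singleton[of "0::real"]
    by eventually_elim (auto simp: indicator_def max_def)
  then have "has_bochner_integral lborel (\<lambda>x. max 0 (c - \<bar>x\<bar>) * F'' x)
      ((((c - c) * F' c + F c) - ((c - 0) * F' 0 + F 0))
        + (((c + 0) * F' 0 - F 0) - ((c + - c) * F' (- c) - F (- c))))"
    using has_bochner_integral_add[OF R L]
    by (subst has_bochner_integral_cong_AE[symmetric]) auto
  then show ?thesis by (simp add: algebra_simps)
qed

lemma opt_density_eq_tents:
  assumes "0 \<le> xt" "xt < xs"
  shows "opt_density xs xt x = (max 0 (xs - \<bar>x\<bar>) - max 0 (xt - \<bar>x\<bar>)) / (xs\<^sup>2 - xt\<^sup>2)"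
proof -
  \<comment> \<open>On the plateau the tents differ by the constant xs - xt, and this factorization
    gives its height.\<close>
  have "xs\<^sup>2 - xt\<^sup>2 = (xs - xt) * (xs + xt)" by (simp add: power2_eq_square algebra_simps)
  then have "1 / (xs + xt) = (xs - xt) / (xs\<^sup>2 - xt\<^sup>2)" using assms by simp
  then show ?thesis
    using assms by (auto simp: opt_density_def max_def abs_if)
qed

lemma opt_density_measurable[measurable]: "opt_density xs xt \<in> borel_measurable borel"
  unfolding opt_density_def by measurable

lemma opt_density_nonneg:
  assumes "0 \<le> xt" "xt < xs"
  shows "0 \<le> opt_density xs xt x"
proof -
  have "xt\<^sup>2 < xs\<^sup>2" using assms by (intro power_strict_mono) auto
  then show ?thesis using assms by (auto simp: opt_density_eq_tents intro!: divide_nonneg_pos)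
qed

lemma opt_density_has_bochner_integral:
  fixes F F' F'' :: "real \<Rightarrow> real"
  assumes F: "\<And>x. (F has_real_derivative F' x) (at x)"
    and F': "\<And>x. (F' has_real_derivative F'' x) (at x)"
    and cont: "\<And>x. isCont F'' x" and x: "0 \<le> xt" "xt < xs"
  shows "has_bochner_integral lborel (\<lambda>x. opt_density xs xt x * F'' x)
    ((F xs + F (- xs) - F xt - F (- xt)) / (xs\<^sup>2 - xt\<^sup>2))"
proof -
  have "has_bochner_integral lborel
      (\<lambda>x. (max 0 (xs - \<bar>x\<bar>) * F'' x - max 0 (xt - \<bar>x\<bar>) * F'' x) / (xs\<^sup>2 - xt\<^sup>2))
      (((F xs + F (- xs) - 2 * F 0) - (F xt + F (- xt) - 2 * F 0)) / (xs\<^sup>2 - xt\<^sup>2))"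
    using x by (intro has_bochner_integral_divide_zero has_bochner_integral_diff
        tent_has_bochner_integral[OF F F' cont]) auto
  moreover have "(F xs + F (- xs) - 2 * F 0) - (F xt + F (- xt) - 2 * F 0)
      = F xs + F (- xs) - F xt - F (- xt)" by simp
  ultimately show ?thesis
    by (simp only: opt_density_eq_tents[OF x] left_diff_distrib times_divide_eq_left)
qed

text \<open>One formula serves for the total mass, with F = x^2 / 2, and for the running cost, with
  F = r x^4 / 12.\<close>

lemma nn_integral_opt_occupation:
  fixes F F' F'' :: "real \<Rightarrow> real"
  assumes F: "\<And>x. (F has_real_derivative F' x) (at x)"
    and F': "\<And>x. (F' has_real_derivative F'' x) (at x)"
    and cont: "\<And>x. isCont F'' x" and x: "0 \<le> xt" "xt < xs" and nonneg: "\<And>x. 0 \<le> F'' x"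
  shows "(\<integral>\<^sup>+x. ennreal (F'' x) \<partial>opt_occupation xs xt)
    = ennreal ((F xs + F (- xs) - F xt - F (- xt)) / (xs\<^sup>2 - xt\<^sup>2))"
proof -
  have [measurable]: "F'' \<in> borel_measurable borel"
    using cont by (intro borel_measurable_continuous_onI) (simp add: continuous_on_eq_continuous_at)
  have "(\<integral>\<^sup>+x. ennreal (F'' x) \<partial>opt_occupation xs xt)
      = (\<integral>\<^sup>+x. ennreal (opt_density xs xt x * F'' x) \<partial>lborel)"
    unfolding opt_occupation_def
    by (subst nn_integral_density)
      (auto simp: ennreal_mult[OF opt_density_nonneg[OF x] nonneg])
  also have "\<dots> = ennreal ((F xs + F (- xs) - F xt - F (- xt)) / (xs\<^sup>2 - xt\<^sup>2))"
    using opt_density_has_bochner_integral[OF F F' cont x] opt_density_nonneg[OF x] nonneg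
    by (subst nn_integral_eq_integral) (auto simp: has_bochner_integral_iff)
  finally show ?thesis .
qed

lemma prob_space_opt_occupation:
  assumes x: "0 \<le> xt" "xt < xs"
  shows "prob_space (opt_occupation xs xt)"
proof
  have "(\<integral>\<^sup>+x. ennreal 1 \<partial>opt_occupation xs xt)
      = ennreal ((xs\<^sup>2 / 2 + (- xs)\<^sup>2 / 2 - xt\<^sup>2 / 2 - (- xt)\<^sup>2 / 2) / (xs\<^sup>2 - xt\<^sup>2))"
    by (rule nn_integral_opt_occupation[where F' = "\<lambda>x. x"])
      (use x in \<open>auto intro!: derivative_eq_intros\<close>)
  moreover have "xt\<^sup>2 < xs\<^sup>2" using assms by (intro power_strict_mono) auto
  ultimately show "emeasure (opt_occupation xs xt) (space (opt_occupation xs xt)) = 1"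
    by simp
qed

section \<open>Integration against the optimal jump measure\<close>

text \<open>The two atoms, indexed by \<open>bool\<close>: \<open>opt_jump\<close> becomes the image
  of a measure on two points, and its integrals become finite sums.\<close>

definition opt_jump_points :: "real \<Rightarrow> real \<Rightarrow> bool \<Rightarrow> real \<times> real" where
  "opt_jump_points xs xt b = (if b then (xs, xt - xs) else (- xs, - xt + xs))"

text \<open>Since xt < xs both jump sizes are nonzero, so the atoms lie in the state-jump
  space.\<close>

lemma opt_jump_points_measurable:
  assumes "xt < xs"
  shows "opt_jump_points xs xt \<in> measurable (point_measure UNIV c) jump_borel"
  using assms
  by (auto simp: measurable_def space_point_measure sets_point_measure opt_jump_points_def
      jump_borel_def space_restrict_space)

lemma opt_jump_eq_distr:
  assumes x: "0 \<le> xt" "xt < xs" and a: "0 < a"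
  shows "opt_jump a xs xt = distr (point_measure UNIV (\<lambda>_. ennreal (a / (2 * (xs\<^sup>2 - xt\<^sup>2)))))
    jump_borel (opt_jump_points xs xt)" (is "_ = distr ?M _ _")
proof (rule measure_eqI)
  fix A assume "A \<in> sets (opt_jump a xs xt)"
  then have A: "A \<in> sets jump_borel" by simp
  have pos: "0 \<le> a / (xs\<^sup>2 - xt\<^sup>2)"
    using x a power_strict_mono[of xt xs 2] by simp
  have "a / (2 * (xs\<^sup>2 - xt\<^sup>2)) = a / (xs\<^sup>2 - xt\<^sup>2) * (1/2)" by simp
  then have half: "ennreal (a / (2 * (xs\<^sup>2 - xt\<^sup>2))) = ennreal (a / (xs\<^sup>2 - xt\<^sup>2)) * ennreal (1/2)"
    using pos by (simp only: ennreal_mult)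
  have "emeasure (distr ?M jump_borel (opt_jump_points xs xt)) A
      = (\<integral>\<^sup>+b. indicator A (opt_jump_points xs xt b) \<partial>?M)"
    using A opt_jump_points_measurable[OF x(2)]
    by (simp add: nn_integral_distr flip: nn_integral_indicator)
  also have "\<dots> = emeasure (opt_jump a xs xt) A"
    unfolding nn_integral_point_measure_finite[OF finite] half UNIV_bool
    by (simp add: emeasure_opt_jump[OF A] opt_jump_points_def distrib_left mult.assoc add.commute)
  finally show "emeasure (opt_jump a xs xt) A = emeasure (distr ?M jump_borel (opt_jump_points xs xt)) A"
    by simp
qed simp

lemma borel_measurable_jump_borel:
  "g \<in> borel_measurable borel \<Longrightarrow> g \<in> borel_measurable jump_borel"
  unfolding jump_borel_def by (rule measurable_restrict_space1)

lemma nn_integral_opt_jump: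
  assumes x: "0 \<le> xt" "xt < xs" and a: "0 < a" and g: "g \<in> borel_measurable borel"
    and nonneg: "\<And>p. 0 \<le> g p"
  shows "(\<integral>\<^sup>+p. ennreal (g p) \<partial>opt_jump a xs xt)
    = ennreal (a / (2 * (xs\<^sup>2 - xt\<^sup>2)) * (g (xs, xt - xs) + g (- xs, - xt + xs)))"
proof -
  have "xt\<^sup>2 < xs\<^sup>2" using x by (intro power_strict_mono) auto
  then obtain K where K: "K = a / (2 * (xs\<^sup>2 - xt\<^sup>2))" and pos: "0 \<le> K" using a by simp
  show ?thesis
    unfolding opt_jump_eq_distr[OF x a] K[symmetric]
    by (subst nn_integral_distr[OF opt_jump_points_measurable[OF x(2)]])
      (use borel_measurable_jump_borel[OF g] pos nonneg in
        \<open>auto simp: nn_integral_point_measure_finite UNIV_bool opt_jump_points_def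
          ennreal_mult ennreal_plus distrib_left\<close>)
qed

lemma integral_opt_jump:
  fixes g :: "real \<times> real \<Rightarrow> real"
  assumes x: "0 \<le> xt" "xt < xs" and a: "0 < a" and g: "g \<in> borel_measurable borel"
  shows "(\<integral>p. g p \<partial>opt_jump a xs xt)
    = a / (2 * (xs\<^sup>2 - xt\<^sup>2)) * (g (xs, xt - xs) + g (- xs, - xt + xs))"
proof -
  have "xt\<^sup>2 < xs\<^sup>2" using x by (intro power_strict_mono) auto
  then obtain K where K: "K = a / (2 * (xs\<^sup>2 - xt\<^sup>2))" and pos: "0 \<le> K" using a by simp
  show ?thesis
    unfolding opt_jump_eq_distr[OF x a] K[symmetric]
    using pos
    by (subst integral_distr[OF opt_jump_points_measurable[OF x(2)] borel_measurable_jump_borel[OF g]])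
      (simp add: lebesgue_integral_point_measure_finite UNIV_bool opt_jump_points_def distrib_left)
qed

section \<open>Admissibility and cost of the candidate\<close>

text \<open>Diffusion contributes a/2 times f(xs) + f(-xs) - f(xt) - f(-xt), over xs^2 - xt^2; the
  jumps from xs to xt and from -xs to -xt contribute the negative of this.\<close>

lemma admissible_optimum:
  assumes x: "0 \<le> xt" "xt < xs" and a: "0 < a"
  shows "admissible a (opt_occupation xs xt) (opt_jump a xs xt)"
  unfolding admissible_def
proof (intro conjI ballI)
  show "prob_space (opt_occupation xs xt)" by (rule prob_space_opt_occupation[OF x])
  show "sets (opt_occupation xs xt) = sets borel" by (simp add: opt_occupation_def)
  show "finite_measure (opt_jump a xs xt)"
    using nn_integral_opt_jump[OF x a, of "\<lambda>_. 1"]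
    by (intro finite_measureI) simp
  show "sets (opt_jump a xs xt) = sets jump_borel" by simp
  fix f assume f: "f \<in> C2_compact"
  have df: "(f has_real_derivative deriv f x) (at x)" and
    df': "(deriv f has_real_derivative deriv (deriv f) x) (at x)" and
    cont: "isCont (deriv (deriv f)) x" for x
    using f by (auto simp: C2_compact_def DERIV_deriv_iff_real_differentiable
        continuous_on_eq_continuous_at)
  have [measurable]: "f \<in> borel_measurable borel" "deriv (deriv f) \<in> borel_measurable borel"
    using C2_compact_continuous[OF f] f
    by (auto simp: C2_compact_def intro: borel_measurable_continuous_onI)
  have "(\<integral>x. 1/2 * a * deriv (deriv f) x \<partial>opt_occupation xs xt)
      = 1/2 * a * (\<integral>x. opt_density xs xt x * deriv (deriv f) x \<partial>lborel)"
    unfolding opt_occupation_def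
    by (subst integral_density) (auto simp: opt_density_nonneg[OF x] mult_ac)
  also have "\<dots> = 1/2 * a * ((f xs + f (- xs) - f xt - f (- xt)) / (xs\<^sup>2 - xt\<^sup>2))"
    using opt_density_has_bochner_integral[OF df df' cont x] by (simp add: has_bochner_integral_iff)
  finally have 1: "(\<integral>x. 1/2 * a * deriv (deriv f) x \<partial>opt_occupation xs xt)
    = 1/2 * a * ((f xs + f (- xs) - f xt - f (- xt)) / (xs\<^sup>2 - xt\<^sup>2))" .
  have 2: "(\<integral>(x, \<xi>). f (x + \<xi>) - f x \<partial>opt_jump a xs xt)
    = a / (2 * (xs\<^sup>2 - xt\<^sup>2)) * ((f xt - f xs) + (f (- xt) - f (- xs)))"
    by (subst integral_opt_jump[OF x a]) (auto simp: borel_prod[symmetric])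
  have "xs\<^sup>2 - xt\<^sup>2 \<noteq> 0" using x power_strict_mono[of xt xs 2] by simp
  then show "(\<integral>x. 1/2 * a * deriv (deriv f) x \<partial>opt_occupation xs xt)
      + (\<integral>(x, \<xi>). f (x + \<xi>) - f x \<partial>opt_jump a xs xt) = 0"
    unfolding 1 2 by (simp add: field_simps)
qed

text \<open>With D = xs^2 - xt^2, the running cost is -a \<theta>1 (xs^4 - xt^4) / D and, by value
  matching, the jump cost is a (P(xs) - P(xt)) / D. The quartic terms cancel.\<close>

lemma cost_optimum:
  assumes x: "0 \<le> xt" "xt < xs" and pos: "0 < a" "0 < r" "0 < k" "0 \<le> h"
    and theta: "6 * a * \<theta>1 + r = 0"
    and value_match: "quartic \<theta>1 \<theta>2 xs - quartic \<theta>1 \<theta>2 xt = k + h * (xs - xt)"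
  shows "cost r k h (opt_occupation xs xt) (opt_jump a xs xt) = ennreal (a * \<theta>2)"
proof -
  have lt: "xt\<^sup>2 < xs\<^sup>2" "xt ^ 4 < xs ^ 4" using x by (auto intro!: power_strict_mono)
  have 1: "(\<integral>\<^sup>+x. ennreal (r * x\<^sup>2) \<partial>opt_occupation xs xt)
    = ennreal ((r * xs ^ 4 / 12 + r * (- xs) ^ 4 / 12 - r * xt ^ 4 / 12 - r * (- xt) ^ 4 / 12)
        / (xs\<^sup>2 - xt\<^sup>2))"
    by (rule nn_integral_opt_occupation[where F' = "\<lambda>x. r * x ^ 3 / 3"])
      (use x pos in \<open>auto intro!: derivative_eq_intros continuous_intros\<close>)
  have 2: "(\<integral>\<^sup>+(x, \<xi>). ennreal (k + h * \<bar>\<xi>\<bar>) \<partial>opt_jump a xs xt)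
    = ennreal (a / (2 * (xs\<^sup>2 - xt\<^sup>2)) * (2 * (k + h * (xs - xt))))"
    using nn_integral_opt_jump[OF x pos(1), of "\<lambda>(x, \<xi>). k + h * \<bar>\<xi>\<bar>"] x pos
    by (simp add: split_beta' borel_prod[symmetric])
  have r: "r = - (6 * a * \<theta>1)" using theta by simp
  have "(r * xs ^ 4 / 12 + r * (- xs) ^ 4 / 12 - r * xt ^ 4 / 12 - r * (- xt) ^ 4 / 12)
      / (xs\<^sup>2 - xt\<^sup>2) + a / (2 * (xs\<^sup>2 - xt\<^sup>2)) * (2 * (k + h * (xs - xt))) = a * \<theta>2"
    (is "?N / ?D + a / (2 * ?D) * (2 * ?X) = _")
  proof -
    have cancel: "a / (2 * D) * (2 * X) = a * X / D" for D X :: real by simp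
    have sum: "?N + a * ?X = a * \<theta>2 * ?D"
      unfolding r value_match[symmetric] quartic_def by (simp add: algebra_simps)
    show ?thesis
      unfolding cancel add_divide_distrib[of ?N, symmetric] sum using lt by simp
  qed
  \<comment> \<open>Both summands must be nonnegative for \<open>ennreal\<close> to be additive on
    them.\<close>
  moreover have "0 \<le> (r * xs ^ 4 / 12 + r * (- xs) ^ 4 / 12 - r * xt ^ 4 / 12 - r * (- xt) ^ 4 / 12)
      / (xs\<^sup>2 - xt\<^sup>2)"
    using lt pos by (intro divide_nonneg_pos) auto
  moreover have "0 \<le> a / (2 * (xs\<^sup>2 - xt\<^sup>2)) * (2 * (k + h * (xs - xt)))"
    using lt x pos by (intro mult_nonneg_nonneg divide_nonneg_pos add_nonneg_nonneg) auto
  ultimately show ?thesis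
    unfolding cost_def 1 2 by (simp only: ennreal_plus[symmetric])
qed

section \<open>The value function and its second differences\<close>

text \<open>Monotonicity and midpoint convexity of powers on the half-line; the inequality between
  \<open>u\<close> and the midpoint allows \<open>u\<close> to be a convex function of
  position.\<close>

lemma power_midpoint_le:
  fixes u p q :: real
  assumes "0 \<le> u" "0 \<le> p" "0 \<le> q" "2 * u \<le> p + q"
  shows "2 * u ^ n \<le> p ^ n + q ^ n"
proof -
  have cvx: "convex_on {0::real..} (\<lambda>x. x ^ n)"
    using convex_power_odd[of n] convex_on_subset[OF convex_power_even[of n]] by (cases "even n") auto
  have "u ^ n \<le> ((1 - 1/2) *\<^sub>R p + (1/2) *\<^sub>R q) ^ n"
    using assms by (intro power_mono) auto
  also have "\<dots> \<le> (1 - 1/2) * p ^ n + (1/2) * q ^ n"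
    using assms by (intro convex_onD[OF cvx]) auto
  finally show ?thesis by simp
qed

lemma DERIV_quartic: "(quartic \<theta>1 \<theta>2 has_real_derivative 4 * \<theta>1 * x ^ 3 + 2 * \<theta>2 * x) (at x)"
  unfolding quartic_def by (auto intro!: derivative_eq_intros simp: algebra_simps)

lemma deriv_quartic: "deriv (quartic \<theta>1 \<theta>2) x = 4 * \<theta>1 * x ^ 3 + 2 * \<theta>2 * x"
  by (rule DERIV_imp_deriv[OF DERIV_quartic])

text \<open>The value function: \<open>quartic\<close> on \<open>[- xs, xs]\<close>, continued with slope \<open>\<plusminus>h\<close> outside. The
  correction term is the resulting difference, divided by \<open>-\<theta>1\<close> and expanded in powers of the
  overshoot \<open>u\<close>; its coefficients are nonnegative, so it is convex.\<close>

definition value_fun :: "real \<Rightarrow> real \<Rightarrow> real \<Rightarrow> real \<Rightarrow> real \<Rightarrow> real" where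
  "value_fun \<theta>1 \<theta>2 xs xt x = (let u = max 0 (\<bar>x\<bar> - xs) in quartic \<theta>1 \<theta>2 x -
     \<theta>1 * (u ^ 4 + 4 * xs * u ^ 3 + (4 * xs\<^sup>2 - 2 * xt * xs - 2 * xt\<^sup>2) * u\<^sup>2))"

lemma value_fun_abs: "value_fun \<theta>1 \<theta>2 xs xt \<bar>x\<bar> = value_fun \<theta>1 \<theta>2 xs xt x"
  by (simp add: value_fun_def quartic_def)

lemma continuous_value_fun: "continuous_on A (value_fun \<theta>1 \<theta>2 xs xt)"
  unfolding value_fun_def Let_def quartic_def by (intro continuous_intros)

text \<open>The left side is the exact second difference of the quartic; the correction adds a
  nonnegative one, as it is convex.\<close>

lemma value_fun_second_difference:
  assumes "\<theta>1 \<le> 0" "0 \<le> xt" "xt \<le> xs"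
  shows "d\<^sup>2 * (12 * \<theta>1 * x\<^sup>2 + 2 * \<theta>2 + 2 * \<theta>1 * d\<^sup>2)
    \<le> value_fun \<theta>1 \<theta>2 xs xt (x + d) - 2 * value_fun \<theta>1 \<theta>2 xs xt x + value_fun \<theta>1 \<theta>2 xs xt (x - d)"
proof -
  define u where "u y = max 0 (\<bar>y\<bar> - xs)" for y
  define e where "e = 4 * xs\<^sup>2 - 2 * xt * xs - 2 * xt\<^sup>2"
  define g where "g p = p ^ 4 + 4 * xs * p ^ 3 + e * p\<^sup>2" for p
  have "2 * \<bar>x\<bar> \<le> \<bar>x + d\<bar> + \<bar>x - d\<bar>" by linarith
  then have u: "2 * u x \<le> u (x + d) + u (x - d)" by (auto simp: u_def max_def)
  have "xt * xs \<le> xs * xs" "xt * xt \<le> xs * xs"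
    using assms by (auto intro: mult_mono)
  then have e: "0 \<le> e" by (simp add: e_def power2_eq_square)
  have pw: "2 * u x ^ n \<le> u (x + d) ^ n + u (x - d) ^ n" for n
    using u by (intro power_midpoint_le) (auto simp: u_def)
  have "4 * xs * (2 * u x ^ 3) \<le> 4 * xs * (u (x + d) ^ 3 + u (x - d) ^ 3)"
    using assms by (intro mult_left_mono pw) auto
  moreover have "e * (2 * (u x)\<^sup>2) \<le> e * ((u (x + d))\<^sup>2 + (u (x - d))\<^sup>2)"
    using e by (intro mult_left_mono pw)
  ultimately have "2 * g (u x) \<le> g (u (x + d)) + g (u (x - d))"
    using pw[of 4] unfolding g_def by (simp add: algebra_simps)
  then have convex: "0 \<le> - \<theta>1 * (g (u (x + d)) + g (u (x - d)) - 2 * g (u x))"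
    using assms by (intro mult_nonneg_nonneg) auto
  have w_eq: "value_fun \<theta>1 \<theta>2 xs xt y = quartic \<theta>1 \<theta>2 y - \<theta>1 * g (u y)" for y
    by (simp add: value_fun_def u_def g_def e_def Let_def)
  have "quartic \<theta>1 \<theta>2 (x + d) - 2 * quartic \<theta>1 \<theta>2 x + quartic \<theta>1 \<theta>2 (x - d)
    = d\<^sup>2 * (12 * \<theta>1 * x\<^sup>2 + 2 * \<theta>2 + 2 * \<theta>1 * d\<^sup>2)"
    unfolding quartic_def by algebra
  then show ?thesis using convex unfolding w_eq by (simp add: algebra_simps)
qed

section \<open>Consequences of the optimality system\<close>

context
  fixes \<theta>1 \<theta>2 xs xt h k :: real
  assumes theta1: "\<theta>1 < 0" and xt: "0 \<le> xt" and xt_xs: "xt < xs" and h: "0 \<le> h" and k: "0 \<le> k"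
    and match: "quartic \<theta>1 \<theta>2 xs - quartic \<theta>1 \<theta>2 xt = k + h * (xs - xt)"
    and slope_xs: "4 * \<theta>1 * xs ^ 3 + 2 * \<theta>2 * xs = h"
    and slope_xt: "4 * \<theta>1 * xt ^ 3 + 2 * \<theta>2 * xt = h"
begin

text \<open>Subtract the two slope conditions and divide by xs - xt.\<close>

lemma theta2_eq: "\<theta>2 = - 2 * \<theta>1 * (xt\<^sup>2 + xt * xs + xs\<^sup>2)"
proof -
  have "(xs - xt) * (\<theta>2 + 2 * \<theta>1 * (xt\<^sup>2 + xt * xs + xs\<^sup>2)) = 0"
    using slope_xs slope_xt by (simp add: algebra_simps power2_eq_square power3_eq_cube)
  then show ?thesis using xt_xs by simp
qed

text \<open>\<open>xs\<close> and \<open>xt\<close> are roots of the depressed cubic \<open>P' - h\<close>, so the third root is \<open>- (xs + xt)\<close>.\<close>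

lemma h_eq: "h = - 4 * \<theta>1 * xt * xs * (xt + xs)"
  unfolding slope_xt[symmetric] theta2_eq by algebra

lemma slope_minus_h:
  "4 * \<theta>1 * x ^ 3 + 2 * \<theta>2 * x - h = 4 * \<theta>1 * ((x - xt) * (x - xs) * (x + xt + xs))"
  using theta2_eq h_eq by algebra

lemma value_fun_inside: "0 \<le> x \<Longrightarrow> x \<le> xs \<Longrightarrow> value_fun \<theta>1 \<theta>2 xs xt x = quartic \<theta>1 \<theta>2 x"
  by (simp add: value_fun_def)

text \<open>In the Taylor expansion of P at xs the linear coefficient is P'(xs) = h, and the terms
  of order 2 to 4 are exactly those that \<open>value_fun\<close> subtracts.\<close>

lemma value_fun_outside:
  assumes "xs \<le> x"
  shows "value_fun \<theta>1 \<theta>2 xs xt x = quartic \<theta>1 \<theta>2 xs + h * (x - xs)"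
proof -
  have u: "max 0 (\<bar>x\<bar> - xs) = x - xs" using assms xt xt_xs by simp
  show ?thesis
    unfolding value_fun_def Let_def quartic_def u h_eq theta2_eq by algebra
qed

lemma quartic_mono:
  assumes "0 \<le> s" "s \<le> t" "t \<le> xs"
  shows "quartic \<theta>1 \<theta>2 s \<le> quartic \<theta>1 \<theta>2 t"
proof (rule DERIV_nonneg_imp_nondecreasing[OF \<open>s \<le> t\<close>])
  fix x assume x: "s \<le> x" "x \<le> t"
  then have "x\<^sup>2 \<le> xs\<^sup>2" using assms by (intro power_mono) auto
  moreover have "0 \<le> xt\<^sup>2 + xt * xs" using xt xt_xs by simp
  ultimately have "0 \<le> x * (xt\<^sup>2 + xt * xs + xs\<^sup>2 - x\<^sup>2)"
    using x assms by (intro mult_nonneg_nonneg) linarith+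
  then have "0 \<le> (- 4 * \<theta>1) * (x * (xt\<^sup>2 + xt * xs + xs\<^sup>2 - x\<^sup>2))"
    using theta1 by (intro mult_nonneg_nonneg[of "- 4 * \<theta>1"]) auto
  moreover have "4 * \<theta>1 * x ^ 3 + 2 * \<theta>2 * x = (- 4 * \<theta>1) * (x * (xt\<^sup>2 + xt * xs + xs\<^sup>2 - x\<^sup>2))"
    unfolding theta2_eq by algebra
  ultimately have "0 \<le> 4 * \<theta>1 * x ^ 3 + 2 * \<theta>2 * x" by simp
  then show "\<exists>y. (quartic \<theta>1 \<theta>2 has_real_derivative y) (at x) \<and> 0 \<le> y"
    using DERIV_quartic by blast
qed

lemma value_fun_mono:
  assumes "0 \<le> s" "s \<le> t"
  shows "value_fun \<theta>1 \<theta>2 xs xt s \<le> value_fun \<theta>1 \<theta>2 xs xt t"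
proof -
  have *: "0 \<le> h * (x - xs)" if "xs \<le> x" for x using h that by simp
  have **: "h * (s - xs) \<le> h * (t - xs)" using h assms by (intro mult_left_mono) auto
  consider "t \<le> xs" | "s \<le> xs" "xs \<le> t" | "xs \<le> s" by linarith
  then show ?thesis
    using assms * ** quartic_mono[of s t] quartic_mono[of s xs]
    by cases (simp_all add: value_fun_inside value_fun_outside, fastforce)
qed

text \<open>Tilting by -h x turns the inequality for downward jumps into an oscillation bound.
  Tangency at xt yields the factor (x - xt)^2, whose cofactor has a sign on [0, xs]; beyond xs the
  tilted function is constant.\<close>

lemma value_fun_tilted_min:
  assumes "0 \<le> x"
  shows "value_fun \<theta>1 \<theta>2 xs xt xt - h * xt \<le> value_fun \<theta>1 \<theta>2 xs xt x - h * x"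
proof -
  have *: "quartic \<theta>1 \<theta>2 xt - h * xt \<le> quartic \<theta>1 \<theta>2 x - h * x" if "0 \<le> x" "x \<le> xs" for x
  proof -
    have "xt * x \<le> xt * xs" "x * x \<le> xs * xs" "xt * xt \<le> xs * xs"
      using that xt xt_xs by (auto intro!: mult_mono)
    then have "0 \<le> 2 * xs\<^sup>2 + 2 * xt * xs - xt\<^sup>2 - 2 * xt * x - x\<^sup>2"
      unfolding power2_eq_square by linarith
    then have "0 \<le> - \<theta>1 * ((x - xt)\<^sup>2 * (2 * xs\<^sup>2 + 2 * xt * xs - xt\<^sup>2 - 2 * xt * x - x\<^sup>2))"
      using theta1 by (intro mult_nonneg_nonneg) auto
    also have "\<dots> = (quartic \<theta>1 \<theta>2 x - h * x) - (quartic \<theta>1 \<theta>2 xt - h * xt)"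
      unfolding quartic_def h_eq theta2_eq by algebra
    finally show ?thesis by simp
  qed
  show ?thesis
    using *[OF assms] *[of xs] xt xt_xs
    by (cases "x \<le> xs") (auto simp: value_fun_inside value_fun_outside assms algebra_simps)
qed

text \<open>The companion bound: tangency at xs yields the factor (x - xs)^2.\<close>

lemma value_fun_tilted_max:
  assumes "xt \<le> x"
  shows "value_fun \<theta>1 \<theta>2 xs xt x - h * x \<le> value_fun \<theta>1 \<theta>2 xs xt xs - h * xs"
proof -
  have *: "quartic \<theta>1 \<theta>2 x - h * x \<le> quartic \<theta>1 \<theta>2 xs - h * xs" if "xt \<le> x"
  proof -
    have "xt * xt \<le> x * x" "xs * xt \<le> xs * x" "xt * xt \<le> xs * xs"
      using that xt xt_xs by (auto intro!: mult_mono)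
    then have "0 \<le> x\<^sup>2 + 2 * xs * x + xs\<^sup>2 - 2 * xt * xs - 2 * xt\<^sup>2"
      unfolding power2_eq_square by (simp add: mult.commute)
    then have "0 \<le> - \<theta>1 * ((x - xs)\<^sup>2 * (x\<^sup>2 + 2 * xs * x + xs\<^sup>2 - 2 * xt * xs - 2 * xt\<^sup>2))"
      using theta1 by (intro mult_nonneg_nonneg) auto
    also have "\<dots> = (quartic \<theta>1 \<theta>2 xs - h * xs) - (quartic \<theta>1 \<theta>2 x - h * x)"
      unfolding quartic_def h_eq theta2_eq by algebra
    finally show ?thesis by simp
  qed
  show ?thesis
    using *[OF assms] xt xt_xs assms
    by (cases "x \<le> xs") (auto simp: value_fun_inside value_fun_outside algebra_simps)
qed

lemma value_fun_tilted_decreasing: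
  assumes "0 \<le> t" "t \<le> s" "s \<le> xt"
  shows "value_fun \<theta>1 \<theta>2 xs xt s - h * s \<le> value_fun \<theta>1 \<theta>2 xs xt t - h * t"
proof -
  have "quartic \<theta>1 \<theta>2 s - h * s \<le> quartic \<theta>1 \<theta>2 t - h * t"
  proof (rule DERIV_nonpos_imp_nonincreasing[OF \<open>t \<le> s\<close>])
    fix x assume x: "t \<le> x" "x \<le> s"
    then have "0 \<le> (x - xt) * (x - xs) * (x + xt + xs)"
      using assms xt_xs by (intro mult_nonneg_nonneg mult_nonpos_nonpos) auto
    then have "4 * \<theta>1 * x ^ 3 + 2 * \<theta>2 * x - h \<le> 0"
      unfolding slope_minus_h using theta1 by (simp add: mult_nonpos_nonneg)
    moreover have "((\<lambda>x. quartic \<theta>1 \<theta>2 x - h * x) has_real_derivative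
        4 * \<theta>1 * x ^ 3 + 2 * \<theta>2 * x - h) (at x)"
      by (auto intro!: derivative_eq_intros DERIV_quartic)
    ultimately show "\<exists>y. ((\<lambda>x. quartic \<theta>1 \<theta>2 x - h * x) has_real_derivative y) (at x) \<and> y \<le> 0"
      by blast
  qed
  then show ?thesis using assms xt_xs by (simp add: value_fun_inside)
qed

text \<open>By evenness the half-line suffices. Moves away from 0 use monotonicity; moves towards 0
  starting below xt use the decreasing tilt; those starting above xt gain at most the tilted maximum
  minus minimum, which is k by value matching.\<close>

lemma value_fun_jump:
  "value_fun \<theta>1 \<theta>2 xs xt x - value_fun \<theta>1 \<theta>2 xs xt y \<le> k + h * \<bar>x - y\<bar>"
proof -
  let ?w = "value_fun \<theta>1 \<theta>2 xs xt"
  have half_line: "?w s - ?w t \<le> k + h * \<bar>s - t\<bar>" if s: "0 \<le> s" and t: "0 \<le> t" for s t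
  proof -
    have gap: "(?w xs - h * xs) - (?w xt - h * xt) = k"
      using match xt xt_xs by (simp add: value_fun_inside algebra_simps)
    consider "s \<le> t" | "t \<le> s" "s \<le> xt" | "t \<le> s" "xt \<le> s" by linarith
    then show ?thesis
    proof cases
      case 1
      have "0 \<le> h * \<bar>s - t\<bar>" using h by simp
      then show ?thesis using value_fun_mono[OF s 1] k by linarith
    next
      case 2
      then show ?thesis
        using value_fun_tilted_decreasing[OF t 2] k by (simp add: algebra_simps)
    next
      case 3
      then show ?thesis
        using value_fun_tilted_min[OF t] value_fun_tilted_max[OF 3(2)] gap
        by (simp add: algebra_simps)
    qed
  qed
  have "?w x - ?w y \<le> k + h * \<bar>\<bar>x\<bar> - \<bar>y\<bar>\<bar>"
    using half_line[of "\<bar>x\<bar>" "\<bar>y\<bar>"] by (simp add: value_fun_abs)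
  also have "\<dots> \<le> k + h * \<bar>x - y\<bar>"
    using h by (intro add_left_mono mult_left_mono) auto
  finally show ?thesis .
qed

lemma value_fun_0: "value_fun \<theta>1 \<theta>2 xs xt 0 = 0"
  using xt xt_xs by (simp add: value_fun_def quartic_def)

lemma value_fun_nonneg: "0 \<le> value_fun \<theta>1 \<theta>2 xs xt x"
  using value_fun_mono[of 0 "\<bar>x\<bar>"] by (simp add: value_fun_0 value_fun_abs)

text \<open>The value function is truncated far out and then smoothed at scale \<open>d\<close>. The truncation does
  not spoil the bound on the second derivative: outside a large interval the quadratic on the left
  is below any second difference quotient of a nonnegative function of linear growth.\<close>

lemma C2_test_function:
  assumes d: "0 < d"
  obtains f where "f \<in> C2_compact"
    "\<And>x. 12 * \<theta>1 * x\<^sup>2 + 2 * \<theta>2 + 2 * \<theta>1 * d\<^sup>2 \<le> deriv (deriv f) x"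
    "\<And>x y. f x - f y \<le> k + h * \<bar>x - y\<bar>"
proof -
  let ?w = "value_fun \<theta>1 \<theta>2 xs xt"
  define c where "c = 2 * k + 2 * h + 2 * d\<^sup>2 * \<bar>\<theta>2\<bar>"
  \<comment> \<open>Beyond R the quadratic term outweighs c|x|; the summand 1 ensures |x| \<ge> 1,
    so constants are absorbed into c|x|.\<close>
  define R where "R = 1 + c / (- 12 * \<theta>1 * d\<^sup>2)"
  have c: "0 \<le> c" using h k by (simp add: c_def)
  have coef: "0 < - 12 * \<theta>1 * d\<^sup>2" using theta1 d by (simp add: mult_neg_pos)
  have R: "1 \<le> R" "c \<le> - 12 * \<theta>1 * d\<^sup>2 * R"
    using c coef by (auto simp: R_def field_simps)
  \<comment> \<open>Agreement up to R + d, since the second difference at |x| \<le> R also samples x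
    + d and x - d.\<close>
  obtain W B where W: "continuous_on UNIV W" "\<And>x. 0 \<le> W x" "\<And>x. W x \<le> ?w x"
    "\<And>x. \<bar>x\<bar> \<le> R + d \<Longrightarrow> W x = ?w x" "\<And>x. B \<le> \<bar>x\<bar> \<Longrightarrow> W x = 0"
    "\<And>x y. W x - W y \<le> k + h * \<bar>x - y\<bar>"
    using compact_cutoff[OF continuous_value_fun value_fun_nonneg value_fun_0 value_fun_jump k h,
        of "R + d"] R d by auto
  obtain f where f: "f \<in> C2_compact"
    "\<And>x. deriv (deriv f) x = (W (x + d) - 2 * W x + W (x - d)) / d\<^sup>2"
    "\<And>x y c. (\<And>z. W (x + z) - W (y + z) \<le> c) \<Longrightarrow> f x - f y \<le> c"
    using C2_smoothing[OF W(1) d W(5)] by blast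
  have "12 * \<theta>1 * x\<^sup>2 + 2 * \<theta>2 + 2 * \<theta>1 * d\<^sup>2 \<le> deriv (deriv f) x" for x
  proof -
    have "d\<^sup>2 * (12 * \<theta>1 * x\<^sup>2 + 2 * \<theta>2 + 2 * \<theta>1 * d\<^sup>2) \<le> W (x + d) - 2 * W x + W (x - d)"
    proof (cases "\<bar>x\<bar> \<le> R")
      case True
      then have "W (x + d) = ?w (x + d)" "W x = ?w x" "W (x - d) = ?w (x - d)"
        using d by (auto intro!: W(4))
      then show ?thesis
        using value_fun_second_difference[of \<theta>1 xt xs d x \<theta>2] theta1 xt xt_xs by simp
    next
      case False
      \<comment> \<open>As W (x + d) and W (x - d) are nonnegative, it suffices to bound the left
        side by -2 W x.\<close>
      have "c * \<bar>x\<bar> \<le> - 12 * \<theta>1 * d\<^sup>2 * R * \<bar>x\<bar>"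
        using R by (intro mult_right_mono) auto
      also have "\<dots> \<le> - 12 * \<theta>1 * d\<^sup>2 * \<bar>x\<bar> * \<bar>x\<bar>"
        using coef False by (intro mult_right_mono mult_left_mono) auto
      finally have quad: "c * \<bar>x\<bar> \<le> - (d\<^sup>2 * (12 * \<theta>1 * x\<^sup>2))"
        by (simp add: power2_eq_square mult_ac)
      have lin: "2 * k + d\<^sup>2 * (2 * \<theta>2) + 2 * (h * \<bar>x\<bar>) \<le> c * \<bar>x\<bar>"
      proof -
        have "1 \<le> \<bar>x\<bar>" using False R by linarith
        then have "2 * k * 1 \<le> 2 * k * \<bar>x\<bar>" "2 * d\<^sup>2 * \<bar>\<theta>2\<bar> * 1 \<le> 2 * d\<^sup>2 * \<bar>\<theta>2\<bar> * \<bar>x\<bar>"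
          using k by (intro mult_left_mono; simp)+
        moreover have "d\<^sup>2 * \<theta>2 \<le> d\<^sup>2 * \<bar>\<theta>2\<bar>" by (intro mult_left_mono) auto
        ultimately show ?thesis by (simp add: c_def algebra_simps)
      qed
      have "W x \<le> k + h * \<bar>x\<bar>"
        using W(3)[of x] value_fun_jump[of x 0] by (simp add: value_fun_0)
      moreover have "d\<^sup>2 * (2 * \<theta>1 * d\<^sup>2) \<le> 0"
        using theta1 by (simp add: mult_nonneg_nonpos mult_nonpos_nonneg)
      ultimately have "d\<^sup>2 * (12 * \<theta>1 * x\<^sup>2 + 2 * \<theta>2 + 2 * \<theta>1 * d\<^sup>2) \<le> - 2 * W x"
        using quad lin unfolding distrib_left by linarith
      then show ?thesis using W(2)[of "x + d"] W(2)[of "x - d"] by linarith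
    qed
    then show ?thesis using d by (simp add: f(2) pos_le_divide_eq mult.commute)
  qed
  moreover have "f x - f y \<le> k + h * \<bar>x - y\<bar>" for x y
    using W(6)[of "x + z" "y + z" for z] by (intro f(3)) simp
  ultimately show thesis using that f(1) by blast
qed

section \<open>The lower bound and the optimal value\<close>

lemma theta2_pos: "0 < \<theta>2"
proof -
  have "0 < xt\<^sup>2 + xt * xs + xs\<^sup>2"
    using xt xt_xs by (intro add_nonneg_pos) auto
  then show ?thesis unfolding theta2_eq using theta1 by (simp add: mult_neg_pos)
qed

lemma admissible_cost_ge:
  assumes adm: "admissible a \<mu> \<rho>" and a: "0 < a" and r: "6 * a * \<theta>1 + r = 0"
  shows "ennreal (a * \<theta>2) \<le> cost r k h \<mu> \<rho>"
proof (rule ennreal_le_epsilon)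
  fix e :: real assume e: "0 < e"
  \<comment> \<open>This scale makes the smoothing error a \<theta>1 d^2 equal to -e.\<close>
  define d where "d = sqrt (e / (- a * \<theta>1))"
  have "0 < - a * \<theta>1" using a theta1 by (simp add: mult_pos_neg)
  then have d: "0 < d" "a * \<theta>1 * d\<^sup>2 = - e" using e by (auto simp: d_def field_simps)
  obtain f where f: "f \<in> C2_compact"
    "\<And>x. 12 * \<theta>1 * x\<^sup>2 + 2 * \<theta>2 + 2 * \<theta>1 * d\<^sup>2 \<le> deriv (deriv f) x"
    "\<And>x y. f x - f y \<le> k + h * \<bar>x - y\<bar>"
    using C2_test_function[OF d(1)] by blast
  have "r \<ge> 0" using r a theta1 mult_pos_neg[of "6 * a" \<theta>1] by linarith
  moreover have "a * \<theta>2 - e - r * x\<^sup>2 \<le> 1/2 * a * deriv (deriv f) x" for x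
  proof -
    have "r = - (6 * a * \<theta>1)" using r by simp
    then have "a * \<theta>2 - e - r * x\<^sup>2 = 1/2 * a * (12 * \<theta>1 * x\<^sup>2 + 2 * \<theta>2 + 2 * \<theta>1 * d\<^sup>2)"
      using d(2) by (simp add: algebra_simps)
    also have "\<dots> \<le> 1/2 * a * deriv (deriv f) x"
      using a by (intro mult_left_mono f(2)) auto
    finally show ?thesis .
  qed
  moreover have "f x - f (x + \<xi>) \<le> k + h * \<bar>\<xi>\<bar>" for x \<xi>
    using f(3)[of x "x + \<xi>"] by simp
  ultimately have "ennreal (a * \<theta>2 - e) \<le> cost r k h \<mu> \<rho>"
    using cost_lower_bound[OF adm f(1)] h k by blast
  then have "ennreal (a * \<theta>2 - e) + ennreal e \<le> cost r k h \<mu> \<rho> + ennreal e"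
    by (rule add_right_mono)
  \<comment> \<open>If e exceeds a \<theta>2 the first summand truncates to 0, but
    \<open>ennreal e\<close> alone suffices.\<close>
  moreover have "ennreal (a * \<theta>2) \<le> ennreal (a * \<theta>2 - e) + ennreal e"
    using e by (cases "e \<le> a * \<theta>2") (auto simp flip: ennreal_plus simp: ennreal_neg intro: ennreal_leI)
  ultimately show "ennreal (a * \<theta>2) \<le> cost r k h \<mu> \<rho> + ennreal e" by (rule order_trans[rotated])
qed

end

theorem proposition4p3:
  fixes a r k h \<theta>1 \<theta>2 xs xt :: real
  assumes "a > 0" and "r > 0" and "k > 0" and "h \<ge> 0"
    and "0 \<le> xt" and "xt < xs"
    and "6 * a * \<theta>1 + r = 0"
    and "quartic \<theta>1 \<theta>2 xs - quartic \<theta>1 \<theta>2 xt = k + h * (xs - xt)"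
    and "deriv (quartic \<theta>1 \<theta>2) xs = h"
    and "deriv (quartic \<theta>1 \<theta>2) xt = h"
  shows "enn2ereal (opt_cost a r k h) = ereal (a * \<theta>2) \<and>
    admissible a (opt_occupation xs xt) (opt_jump a xs xt) \<and>
    cost r k h (opt_occupation xs xt) (opt_jump a xs xt) = opt_cost a r k h"
proof -
  have "a * \<theta>1 < 0" using assms(2,7) by linarith
  then have theta1: "\<theta>1 < 0" using assms(1) by (simp add: mult_less_0_iff)
  have "0 \<le> k" using assms(3) by simp
  note setting = theta1 assms(5,6,4) this assms(8) assms(9,10)[unfolded deriv_quartic]
  have adm: "admissible a (opt_occupation xs xt) (opt_jump a xs xt)"
    by (rule admissible_optimum[OF assms(5,6,1)])
  have cost: "cost r k h (opt_occupation xs xt) (opt_jump a xs xt) = ennreal (a * \<theta>2)"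
    by (rule cost_optimum[OF assms(5,6,1,2,3,4,7,8)])
  have opt: "opt_cost a r k h = ennreal (a * \<theta>2)"
    unfolding opt_cost_def
  proof (rule antisym)
    show "(INF (\<mu>, \<rho>)\<in>{(\<mu>, \<rho>). admissible a \<mu> \<rho>}. cost r k h \<mu> \<rho>) \<le> ennreal (a * \<theta>2)"
      using adm cost by (intro INF_lower2[of "(opt_occupation xs xt, opt_jump a xs xt)"]) auto
    show "ennreal (a * \<theta>2) \<le> (INF (\<mu>, \<rho>)\<in>{(\<mu>, \<rho>). admissible a \<mu> \<rho>}. cost r k h \<mu> \<rho>)"
      using admissible_cost_ge[OF setting _ assms(1,7)] by (auto intro!: INF_greatest)
  qed
  \<comment> \<open>Positivity keeps \<open>ennreal\<close> from truncating the value on conversion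
    to \<open>ereal\<close>.\<close>
  have "0 < a * \<theta>2" using theta2_pos[OF setting] assms(1) by simp
  then show ?thesis using opt adm cost by simp
qed

end
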